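(* Let $A,B,H$ be events with $H\neq\emptyset$ and $AH\neq\emptyset$. Let $P(A|H)=x$, $P(B|AH)=y$, and let all the previsions involved form a coherent assessment. Then $$(A|H)\wedge(B|AH)=AB|H=\mathcal{C}(A|H,B|AH)=(A|H)\cdot(B|AH),$$ and $$\mathbb{P}[(A|H)\wedge(B|AH)]=P(AB|H)=P(A|H)\,P(B|AH),$$ i.e. $\mathbb{P}[(A|H)\wedge(B|AH)]=xy$; in particular $\mathbb{P}[(A|H)\cdot(B|AH)]=\mathbb{P}(A|H)\,\mathbb{P}(B|AH)$.
   Context: Events are identified with their indicators (value 1 if true, 0 if false); $\Omega$ is the sure event, $\emptyset$ the impossible event, $H^c$ the negation of $H$, juxtaposition denotes conjunction (product of indicators). A finite random quantity is a real quantity with finitely many possible values (a finitely-valued real function of the possible outcomes). Equality of random quantities means that they take the same value in every possible outcome. For an event $H\neq\emptyset$ and a finite random quantity $X$ with assessed conditional prevision $\mathbb{P}(X|H)=\mu\in\mathbb{R}$, the conditional random quantity $X|H$ is the random quantity $X|H = XH+\mu H^c$. For an event $A$ with $P(A|H)=x$ one has $A|H=AH+xH^c$. The prevision of an unconditional random quantity $U$ is $\mathbb{P}(U)=\mathbb{P}(U|\Omega)$; the product $(A|H)\cdot(B|K)$ is the product of these numerical quantities. Conjunction: given $P(A|H)=x$, $P(B|K)=y$, the conjunction is the conditional random quantity $(A|H)\wedge(B|K)=\min\{A|H,B|K\}\,|\,(H\vee K)$, where $A|H=AH+xH^c$ and $B|K=BK+yK^c$. Quasi conjunction: $\mathcal{C}(A|H,B|K)=\big[(AH\vee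 H^c)\wedge(BK\vee K^c)\big]\,|\,(H\vee K)$. Coherence: a real function $\mathbb{P}$ on a family $\mathcal{K}$ of finite conditional random quantities is coherent iff for all $n\ge1$, all $X_1|H_1,\dots,X_n|H_n\in\mathcal{K}$ and all real $s_1,\dots,s_n$, setting $\mu_i=\mathbb{P}(X_i|H_i)$ and $\mathcal{G}=\sum_{i=1}^n s_iH_i(X_i-\mu_i)$, the minimum and maximum of the values of $\mathcal{G}$ over the outcomes where $H_1\vee\cdots\vee H_n$ is true satisfy $\min\mathcal{G}\le 0\le\max\mathcal{G}$. *)

theory Defs
  imports Complex_Main "HOL-Library.Indicator_Function"
begin

text \<open>
  The possible outcomes are the elements of the type \<open>'w\<close>, so the sure event is \<open>UNIV\<close> and equality
  of random quantities is equality of functions on \<open>'w\<close>.  A pair \<open>(X, H)\<close> is the object \<open>X|H\<close> to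
  which a prevision is assessed; the numerical quantity \<open>X|H\<close> depends on that assessment and is
  \<open>value_of P (X, H)\<close>.
\<close>

type_synonym 'w event = "'w set"
type_synonym 'w rq = "'w \<Rightarrow> real"
type_synonym 'w cond = "'w rq \<times> 'w event"
type_synonym 'w prevision = "'w cond \<Rightarrow> real"

definition finite_cond :: "'w cond \<Rightarrow> bool" where
  "finite_cond c \<longleftrightarrow> finite (range (fst c)) \<and> snd c \<noteq> {}"

definition gain :: "'w prevision \<Rightarrow> nat \<Rightarrow> (nat \<Rightarrow> 'w rq) \<Rightarrow> (nat \<Rightarrow> 'w event) \<Rightarrow> (nat \<Rightarrow> real) \<Rightarrow> 'w rq" where
  "gain P n X H s = (\<lambda>\<omega>. \<Sum>i=1..n. s i * indicator (H i) \<omega> * (X i \<omega> - P (X i, H i)))"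

text \<open>
  \<open>P\<close> is a total function, but only its values on the family \<open>\<K>\<close> matter.  The set to which \<open>Min\<close> and
  \<open>Max\<close> are applied is finite and nonempty, because every member of \<open>\<K>\<close> is a \<open>finite_cond\<close>.
\<close>

definition coherent :: "'w prevision \<Rightarrow> 'w cond set \<Rightarrow> bool" where
  "coherent P \<K> \<longleftrightarrow>
     (\<forall>c\<in>\<K>. finite_cond c) \<and>
     (\<forall>n\<ge>1. \<forall>X H s. (\<forall>i\<in>{1..n}. (X i, H i) \<in> \<K>) \<longrightarrow>
        Min (gain P n X H s ` (\<Union>i\<in>{1..n}. H i)) \<le> 0 \<and>
        0 \<le> Max (gain P n X H s ` (\<Union>i\<in>{1..n}. H i)))"

definition value_of :: "'w prevision \<Rightarrow> 'w cond \<Rightarrow> 'w rq" where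
  "value_of P c =
     (\<lambda>\<omega>. fst c \<omega> * indicator (snd c) \<omega> + P c * indicator (- snd c) \<omega>)"

definition cond_event :: "'w event \<Rightarrow> 'w event \<Rightarrow> 'w cond" where
  "cond_event A H = (indicator A, H)"

definition unconditional :: "'w rq \<Rightarrow> 'w cond" where
  "unconditional U = (U, UNIV)"

definition conjunction :: "'w prevision \<Rightarrow> 'w event \<Rightarrow> 'w event \<Rightarrow> 'w event \<Rightarrow> 'w event \<Rightarrow> 'w cond" where
  "conjunction P A H B K =
     (\<lambda>\<omega>. min (value_of P (cond_event A H) \<omega>) (value_of P (cond_event B K) \<omega>), H \<union> K)"

definition quasi_conjunction :: "'w event \<Rightarrow> 'w event \<Rightarrow> 'w event \<Rightarrow> 'w event \<Rightarrow> 'w cond" where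
  "quasi_conjunction A H B K =
     cond_event ((A \<inter> H \<union> - H) \<inter> (B \<inter> K \<union> - K)) (H \<union> K)"

definition cond_product :: "'w prevision \<Rightarrow> 'w event \<Rightarrow> 'w event \<Rightarrow> 'w event \<Rightarrow> 'w event \<Rightarrow> 'w rq" where
  "cond_product P A H B K =
     (\<lambda>\<omega>. value_of P (cond_event A H) \<omega> * value_of P (cond_event B K) \<omega>)"

end

theory Submission
  imports Defs
begin

text \<open>
  Every equality of previsions below comes from one principle: a combination of bets whose gain is
  constant wherever some bet is active must have gain \<open>0\<close> (\<open>coherent_constant_gain\<close>).

  Staking \<open>y\<close> on \<open>A|H\<close>, \<open>1\<close> on \<open>B|AH\<close> and \<open>-1\<close> on \<open>AB|H\<close> gives, throughout \<open>H\<close>, the gain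
  \<open>y(A - x) + A(B - y) - (AB - P(AB|H)) = P(AB|H) - xy\<close>, whence the product rule \<open>P(AB|H) = xy\<close>.

  The random quantities defining the conjunction and the quasi conjunction both coincide with \<open>AB\<close>
  on \<open>H\<close>.  For the conjunction this uses coherence once more: where \<open>A\<close> fails, the minimum is
  \<open>min 0 y\<close>, and \<open>y \<ge> 0\<close> because \<open>y\<close> is a conditional probability.  Random quantities that agree on
  the conditioning event have the same conditional prevision, and so the same conditional random
  quantity.

  The numerical product is \<open>AB\<close> on \<open>H\<close> and \<open>xy\<close> off \<open>H\<close>.  By the product rule this is the
  random quantity \<open>AB|H\<close>, and the prevision of a conditional random quantity \<open>X|H\<close>, read as an
  unconditional one, is \<open>P(X|H)\<close>.
\<close>

text \<open>
  The gain of finitely many bets, as a sum over a list of stakes paired with conditional random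
  quantities: concrete combinations of two or three bets can then be written down directly, without
  functions on the indices \<open>1..n\<close>.
\<close>
definition list_gain :: "'w prevision \<Rightarrow> (real \<times> 'w cond) list \<Rightarrow> 'w rq" where
  "list_gain P bs =
     (\<lambda>\<omega>. \<Sum>(s, c)\<leftarrow>bs. s * indicator (snd c) \<omega> * (fst c \<omega> - P c))"

lemma gain_nth_eq_list_gain:
  "gain P (length bs) (\<lambda>i. fst (snd (bs ! (i - 1)))) (\<lambda>i. snd (snd (bs ! (i - 1))))
     (\<lambda>i. fst (bs ! (i - 1))) = list_gain P bs"
proof
  fix \<omega>
  let ?f = "\<lambda>(s, c). s * indicator (snd c) \<omega> * (fst c \<omega> - P c)"
  have "list_gain P bs \<omega> = (\<Sum>i=0..<length bs. ?f (bs ! i))"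
    by (simp add: list_gain_def sum_list_sum_nth)
  also have "\<dots> = (\<Sum>i=1..length bs. ?f (bs ! (i - 1)))"
    by (rule sum.reindex_bij_witness[of _ "\<lambda>i. i - 1" Suc]) auto
  finally show "gain P (length bs) (\<lambda>i. fst (snd (bs ! (i - 1))))
      (\<lambda>i. snd (snd (bs ! (i - 1)))) (\<lambda>i. fst (bs ! (i - 1))) \<omega> = list_gain P bs \<omega>"
    by (simp add: gain_def case_prod_unfold)
qed

lemma finite_range_list_gain:
  assumes "\<And>s c. (s, c) \<in> set bs \<Longrightarrow> finite_cond c"
  shows "finite (range (list_gain P bs))"
  using assms
proof (induction bs)
  case Nil
  then show ?case by (simp add: list_gain_def)
next
  case (Cons b bs)
  obtain s X H where b: "b = (s, (X, H))" by (metis prod.exhaust)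
  have fX: "finite (range X)" using Cons.prems[of s "(X, H)"] b by (simp add: finite_cond_def)
  have fg: "finite (range (list_gain P bs))" using Cons.IH Cons.prems by (meson list.set_intros(2))
  let ?F = "\<lambda>(h, v, g). s * h * (v - P (X, H)) + g"
  let ?S = "{0, 1} \<times> range X \<times> range (list_gain P bs)"
  have "range (list_gain P (b # bs)) \<subseteq> ?F ` ?S"
  proof (rule image_subsetI)
    fix \<omega>
    have "list_gain P (b # bs) \<omega> = ?F (indicator H \<omega>, X \<omega>, list_gain P bs \<omega>)"
      by (simp add: list_gain_def b)
    moreover have "(indicator H \<omega>, X \<omega>, list_gain P bs \<omega>) \<in> ?S"
      by (auto simp: indicator_def)
    ultimately show "list_gain P (b # bs) \<omega> \<in> ?F ` ?S" by (rule image_eqI)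
  qed
  moreover have "finite (?F ` ?S)" using fX fg by simp
  ultimately show ?case by (rule finite_subset)
qed

text \<open>
  No combination of bets wins a positive amount for sure: the finitely many values of the gain attain
  their minimum, which coherence bounds by \<open>0\<close>.
\<close>
lemma coherent_no_sure_gain:
  assumes coh: "coherent P \<K>" and ne: "bs \<noteq> []"
    and mem: "\<And>s c. (s, c) \<in> set bs \<Longrightarrow> c \<in> \<K>"
    and lb: "\<And>\<omega> s c. (s, c) \<in> set bs \<Longrightarrow> \<omega> \<in> snd c \<Longrightarrow> g \<le> list_gain P bs \<omega>"
  shows "g \<le> 0"
proof -
  let ?X = "\<lambda>i. fst (snd (bs ! (i - 1)))"
  let ?H = "\<lambda>i. snd (snd (bs ! (i - 1)))"
  let ?U = "\<Union>i\<in>{1..length bs}. ?H i"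
  have fin_cond: "finite_cond c" if "(s, c) \<in> set bs" for s c
    using coh mem[OF that] by (auto simp: coherent_def)
  have nth: "(fst (bs ! (i - 1)), snd (bs ! (i - 1))) \<in> set bs" if "i \<in> {1..length bs}" for i
    using that by (auto intro: nth_mem)
  have len: "1 \<le> length bs" using ne by (simp add: Suc_leI)
  have X_mem: "\<forall>i\<in>{1..length bs}. (?X i, ?H i) \<in> \<K>"
    using mem[OF nth] by simp
  have "Min (gain P n X H s ` (\<Union>i\<in>{1..n}. H i)) \<le> 0"
    if "1 \<le> n" "\<forall>i\<in>{1..n}. (X i, H i) \<in> \<K>" for n X H s
    using coh that by (simp add: coherent_def)
  from this[OF len X_mem]
  have "Min (gain P (length bs) ?X ?H (\<lambda>i. fst (bs ! (i - 1))) ` ?U) \<le> 0" .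
  then have Min: "Min (list_gain P bs ` ?U) \<le> 0"
    unfolding gain_nth_eq_list_gain .
  have "finite (list_gain P bs ` ?U)"
    using finite_range_list_gain[OF fin_cond] by (meson finite_subset image_mono subset_UNIV)
  moreover have "?H 1 \<noteq> {}" using fin_cond[OF nth[of 1]] len by (simp add: finite_cond_def)
  with len have "list_gain P bs ` ?U \<noteq> {}" by force
  ultimately have "Min (list_gain P bs ` ?U) \<in> list_gain P bs ` ?U" by (rule Min_in)
  then obtain i \<omega> where "i \<in> {1..length bs}" "\<omega> \<in> ?H i"
    and "Min (list_gain P bs ` ?U) = list_gain P bs \<omega>" by blast
  with lb[OF nth] Min show ?thesis by fastforce
qed

lemma list_gain_uminus:
  "list_gain P (map (\<lambda>(s, c). (- s, c)) bs) \<omega> = - list_gain P bs \<omega>"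
  unfolding list_gain_def by (induction bs) auto

text \<open>
  Changing the sign of all stakes changes the sign of the gain, so that a sure loss is excluded
  together with a sure gain.
\<close>
lemma coherent_constant_gain:
  assumes "coherent P \<K>" and "bs \<noteq> []"
    and mem: "\<And>s c. (s, c) \<in> set bs \<Longrightarrow> c \<in> \<K>"
    and const: "\<And>\<omega> s c. (s, c) \<in> set bs \<Longrightarrow> \<omega> \<in> snd c \<Longrightarrow> list_gain P bs \<omega> = g"
  shows "g = 0"
proof -
  have "g \<le> 0"
    using assms by (intro coherent_no_sure_gain[of P \<K> bs]) auto
  moreover have "- g \<le> 0"
    using assms
    by (intro coherent_no_sure_gain[of P \<K> "map (\<lambda>(s, c). (- s, c)) bs"])
      (auto simp: list_gain_uminus)
  ultimately show ?thesis by simp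
qed

lemma coherent_cond_event_nonneg:
  assumes coh: "coherent P \<K>" and mem: "cond_event A H \<in> \<K>"
  shows "0 \<le> P (cond_event A H)"
proof -
  have "- P (cond_event A H) \<le> 0"
    by (rule coherent_no_sure_gain[OF coh, of "[(1, cond_event A H)]"])
      (use mem in \<open>auto simp: list_gain_def cond_event_def\<close>)
  then show ?thesis by simp
qed

text \<open>A bet on \<open>X|H\<close> against \<open>Y|H\<close> has constant gain on \<open>H\<close>.\<close>
lemma coherent_prevision_cong:
  assumes coh: "coherent P \<K>" and mem: "(X, H) \<in> \<K>" "(Y, H) \<in> \<K>"
    and eq: "\<And>\<omega>. \<omega> \<in> H \<Longrightarrow> X \<omega> = Y \<omega>"
  shows "P (X, H) = P (Y, H)"
proof -
  have "P (Y, H) - P (X, H) = 0"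
    by (rule coherent_constant_gain[OF coh, of "[(1, (X, H)), (- 1, (Y, H))]"])
      (use mem eq in \<open>auto simp: list_gain_def\<close>)
  then show ?thesis by simp
qed

lemma coherent_value_of_cong:
  assumes "coherent P \<K>" and "(X, H) \<in> \<K>" "(Y, H) \<in> \<K>"
    and "\<And>\<omega>. \<omega> \<in> H \<Longrightarrow> X \<omega> = Y \<omega>"
  shows "value_of P (X, H) = value_of P (Y, H)"
  using coherent_prevision_cong[OF assms] assms(4)
  by (auto simp: value_of_def indicator_def)

text \<open>
  Off \<open>H\<close> the quantity \<open>X|H\<close> takes the value \<open>P(X|H)\<close>, which is exactly the amount returned by a
  bet on \<open>X|H\<close> that is called off; so an unconditional bet on it against a bet on \<open>X|H\<close> has constant
  gain on the whole space.
\<close>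
lemma coherent_prevision_value_of:
  assumes coh: "coherent P \<K>" and mem: "c \<in> \<K>" "unconditional (value_of P c) \<in> \<K>"
  shows "P (unconditional (value_of P c)) = P c"
proof -
  have "P c - P (unconditional (value_of P c)) = 0"
    by (rule coherent_constant_gain[OF coh,
          of "[(1, unconditional (value_of P c)), (- 1, c)]"])
      (use mem in \<open>auto simp: list_gain_def unconditional_def value_of_def indicator_def\<close>)
  then show ?thesis by simp
qed

lemma coherent_product_rule:
  assumes coh: "coherent P \<K>"
    and mem: "cond_event A H \<in> \<K>" "cond_event B (A \<inter> H) \<in> \<K>" "cond_event (A \<inter> B) H \<in> \<K>"
  shows "P (cond_event (A \<inter> B) H) = P (cond_event A H) * P (cond_event B (A \<inter> H))"
proof -
  let ?bs = "[(P (cond_event B (A \<inter> H)), cond_event A H), (1, cond_event B (A \<inter> H)),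
      (- 1, cond_event (A \<inter> B) H)]"
  have "P (cond_event (A \<inter> B) H) - P (cond_event A H) * P (cond_event B (A \<inter> H)) = 0"
    by (rule coherent_constant_gain[OF coh, of ?bs])
      (use mem in \<open>auto simp: list_gain_def cond_event_def indicator_def algebra_simps\<close>)
  then show ?thesis by simp
qed

theorem mainTheorem8:
  fixes P :: "'w prevision" and \<K> :: "'w cond set"
    and A B H :: "'w event" and x y :: real
  assumes "H \<noteq> {}" and "A \<inter> H \<noteq> {}"
    and "P (cond_event A H) = x" and "P (cond_event B (A \<inter> H)) = y"
    and "coherent P \<K>"
    and "{cond_event A H, cond_event B (A \<inter> H), cond_event (A \<inter> B) H,
          conjunction P A H B (A \<inter> H), quasi_conjunction A H B (A \<inter> H),
          unconditional (cond_product P A H B (A \<inter> H))} \<subseteq> \<K>"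
  shows "value_of P (conjunction P A H B (A \<inter> H)) = value_of P (cond_event (A \<inter> B) H)
    \<and> value_of P (cond_event (A \<inter> B) H) = value_of P (quasi_conjunction A H B (A \<inter> H))
    \<and> value_of P (quasi_conjunction A H B (A \<inter> H)) = cond_product P A H B (A \<inter> H)
    \<and> P (conjunction P A H B (A \<inter> H)) = P (cond_event (A \<inter> B) H)
    \<and> P (cond_event (A \<inter> B) H) = P (cond_event A H) * P (cond_event B (A \<inter> H))
    \<and> P (conjunction P A H B (A \<inter> H)) = x * y
    \<and> P (unconditional (cond_product P A H B (A \<inter> H)))
        = P (cond_event A H) * P (cond_event B (A \<inter> H))"
proof -
  let ?conj = "conjunction P A H B (A \<inter> H)"
  let ?quasi = "quasi_conjunction A H B (A \<inter> H)"
  let ?prod = "cond_product P A H B (A \<inter> H)"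
  let ?AB = "cond_event (A \<inter> B) H"
  note coh = \<open>coherent P \<K>\<close>
  have memA: "cond_event A H \<in> \<K>" and memB: "cond_event B (A \<inter> H) \<in> \<K>" and memAB: "?AB \<in> \<K>"
    and memC: "?conj \<in> \<K>" and memQ: "?quasi \<in> \<K>" and memU: "unconditional ?prod \<in> \<K>"
    using assms(6) by auto
  have union: "H \<union> A \<inter> H = H" by blast
  have y_nonneg: "0 \<le> P (cond_event B (A \<inter> H))"
    by (rule coherent_cond_event_nonneg[OF coh memB])
  have rule: "P ?AB = P (cond_event A H) * P (cond_event B (A \<inter> H))"
    by (rule coherent_product_rule[OF coh memA memB memAB])

  obtain C where C: "?conj = (C, H)"
    and C_AB: "\<And>\<omega>. \<omega> \<in> H \<Longrightarrow> C \<omega> = indicator (A \<inter> B) \<omega>"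
    using y_nonneg
    by (auto simp: conjunction_def union value_of_def cond_event_def indicator_def)
  obtain Q where Q: "?quasi = (Q, H)"
    and Q_AB: "\<And>\<omega>. \<omega> \<in> H \<Longrightarrow> Q \<omega> = indicator (A \<inter> B) \<omega>"
    by (auto simp: quasi_conjunction_def union cond_event_def indicator_def)
  have conj_value: "value_of P ?conj = value_of P ?AB"
    using coherent_value_of_cong[OF coh, of C H "indicator (A \<inter> B)"] memC memAB C C_AB
    by (simp add: cond_event_def)
  have conj_prev: "P ?conj = P ?AB"
    using coherent_prevision_cong[OF coh, of C H "indicator (A \<inter> B)"] memC memAB C C_AB
    by (simp add: cond_event_def)
  have quasi_value: "value_of P ?quasi = value_of P ?AB"
    using coherent_value_of_cong[OF coh, of Q H "indicator (A \<inter> B)"] memQ memAB Q Q_AB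
    by (simp add: cond_event_def)
  have prod_value: "?prod = value_of P ?AB"
    unfolding cond_product_def value_of_def rule
    by (auto simp: cond_event_def indicator_def)
  have "P (unconditional ?prod) = P ?AB"
    using coherent_prevision_value_of[OF coh memAB] memU unfolding prod_value by simp
  with conj_value conj_prev quasi_value prod_value rule assms(3,4) show ?thesis by simp
qed

end
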